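(* Let $d\ge2$ and fix distinct $\gamma^{1},\gamma^{2}\in\mathcal{P}$. For $p\in(0,1)$ let $P_{[p]}$ be the annealed law of the random walk $(X_n)_{n\ge0}$ in the i.i.d. random environment with $\mu(\{\gamma^1\})=p$ and $\mu(\{\gamma^2\})=1-p$. If for every $p\in(0,1)$ there exists a deterministic $v[p]\in\mathbb{R}^d$ such that $P_{[p]}\big(\lim_{n\to\infty}n^{-1}X_n=v[p]\big)=1$, then each coordinate of $v[p]$ is a monotone function of $p$.
   Context: $\mathcal{E}=\{\pm e_i: i=1,\dots,d\}$ is the set of unit vectors in $\mathbb{Z}^d$ and $o$ is the origin. $\mathcal{P}$ is the set of probability measures on $\mathcal{E}$, and $\mu$ is a probability measure on $\mathcal{P}$. $\Omega=\mathcal{P}^{\mathbb{Z}^d}$ carries the product measure $\nu=\mu^{\otimes\mathbb{Z}^d}$; an environment is $\omega=(\omega_x)_{x\in\mathbb{Z}^d}\in\Omega$ (so the $\omega_x$ are i.i.d. with law $\mu$ under $\nu$), and $\omega_x(e)$ means $\omega_x(\{e\})$. Given $\omega$, $\mathbb{P}_\omega$ is the law of the time-homogeneous Markov chain $(X_n)_{n\ge0}$ on $\mathbb{Z}^d$ with $X_0=o$ and transition probability $\omega_x(e)$ from $x$ to $x+e$, $e\in\mathcal{E}$. The annealed law is $P(\cdot)=\int \mathbb{P}_\omega(\cdot)\,d\nu(\omega)$. No ellipticity is assumed: $\omega_x(e)$ may vanish. *)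

theory Defs
  imports "HOL-Probability.Probability"
begin

definition unit_steps :: "(int ^ 'd::finite) set" where
  "unit_steps = (\<Union>i. {axis i 1, - axis i 1})"

text \<open>Probability measures on \<open>unit_steps\<close>, with the \<open>\<sigma>\<close>-algebra generated by the evaluations
  at subsets of \<open>unit_steps\<close> (the Borel \<open>\<sigma>\<close>-algebra of the simplex).\<close>

definition step_laws :: "(int ^ 'd::finite) measure measure" where
  "step_laws = prob_algebra (count_space unit_steps)"

type_synonym 'd env = "int ^ 'd \<Rightarrow> (int ^ 'd) measure"

definition env_law :: "(int ^ 'd::finite) measure measure \<Rightarrow> 'd env measure" where
  "env_law \<mu> = PiM UNIV (\<lambda>_. \<mu>)"

abbreviation path_space :: "(nat \<Rightarrow> int ^ 'd::finite) measure" where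
  "path_space \<equiv> PiM UNIV (\<lambda>_. count_space UNIV)"

text \<open>Conditional law of \<open>X\<^sub>n\<close> given \<open>X\<^sub>0, \<dots>, X\<^sub>n\<^sub>-\<^sub>1\<close> in the fixed environment \<open>w\<close>; the walk starts
  at the origin.\<close>

definition walk_kernel :: "'d::finite env \<Rightarrow> nat \<Rightarrow> (nat \<Rightarrow> int ^ 'd) \<Rightarrow> (int ^ 'd) measure" where
  "walk_kernel w n X =
     (if n = 0 then return (count_space UNIV) 0
      else distr (w (X (n - 1))) (count_space UNIV) (\<lambda>e. X (n - 1) + e))"

text \<open>The path measure with these conditional laws, by the Ionescu-Tulcea theorem;
  see \<open>emeasure_quenched_law_cylinder\<close> for its values on cylinders.\<close>

definition quenched_law :: "'d::finite env \<Rightarrow> (nat \<Rightarrow> int ^ 'd) measure" where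
  "quenched_law w =
     projective_family.lim UNIV (Ionescu_Tulcea.CI (walk_kernel w) (\<lambda>_. count_space UNIV))
       (\<lambda>_. count_space UNIV)"

text \<open>The Giry-monad \<open>bind\<close> is the mixture of the quenched laws; see \<open>emeasure_annealed_law\<close>.\<close>

definition annealed_law :: "(int ^ 'd::finite) measure measure \<Rightarrow> (nat \<Rightarrow> int ^ 'd) measure" where
  "annealed_law \<mu> = env_law \<mu> \<bind> quenched_law"

definition two_point ::
  "(int ^ 'd::finite) measure \<Rightarrow> (int ^ 'd) measure \<Rightarrow> real \<Rightarrow> (int ^ 'd) measure measure" where
  "two_point \<gamma>1 \<gamma>2 p =
     distr (measure_pmf (bernoulli_pmf p)) step_laws (\<lambda>b. if b then \<gamma>1 else \<gamma>2)"

definition real_vec :: "int ^ 'd::finite \<Rightarrow> real ^ 'd" where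
  "real_vec x = (\<chi> i. real_of_int (x $ i))"


subsection \<open>Well-definedness of the laws\<close>

lemma finite_unit_steps: "finite unit_steps"
  by (simp add: unit_steps_def)

lemma space_step_laws:
  "\<gamma> \<in> space step_laws \<longleftrightarrow> prob_space \<gamma> \<and> sets \<gamma> = Pow unit_steps"
  by (auto simp: step_laws_def space_prob_algebra)

lemma singleton_sets_step_laws:
  assumes g: "\<gamma> \<in> space step_laws"
  shows "{\<gamma>} \<in> sets step_laws"
proof -
  have "{\<gamma>} = {m \<in> space step_laws. \<forall>A\<in>Pow unit_steps. emeasure m A = emeasure \<gamma> A}"
    using g by (auto simp: space_step_laws intro!: measure_eqI)
  moreover have "Measurable.pred step_laws (\<lambda>m. emeasure m A = emeasure \<gamma> A)"
    if "A \<subseteq> unit_steps" for A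
  proof -
    have "(\<lambda>m. emeasure m A) \<in> borel_measurable step_laws"
      unfolding step_laws_def using that
      by (intro measurable_compose[OF measurable_prob_algebraD[OF measurable_ident_sets[OF refl]]
            measurable_emeasure_subprob_algebra]) simp
    then show ?thesis by measurable
  qed
  ultimately show ?thesis
    using finite_unit_steps by (auto intro!: sets.sets_Collect_finite_All simp: pred_def)
qed

lemma
  assumes "\<gamma>1 \<in> space step_laws" "\<gamma>2 \<in> space step_laws"
  shows prob_space_two_point: "prob_space (two_point \<gamma>1 \<gamma>2 p)"
    and sets_two_point: "sets (two_point \<gamma>1 \<gamma>2 p) = sets step_laws"
  using assms by (auto simp: two_point_def intro!: measure_pmf.prob_space_distr)

lemma measure_two_point:
  assumes g: "\<gamma>1 \<in> space step_laws" "\<gamma>2 \<in> space step_laws" "\<gamma>1 \<noteq> \<gamma>2" and p: "0 \<le> p" "p \<le> 1"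
  shows "measure (two_point \<gamma>1 \<gamma>2 p) {\<gamma>1} = p" "measure (two_point \<gamma>1 \<gamma>2 p) {\<gamma>2} = 1 - p"
proof -
  have "(\<lambda>b. if b then \<gamma>1 else \<gamma>2) -` {\<gamma>1} = {True}" "(\<lambda>b. if b then \<gamma>1 else \<gamma>2) -` {\<gamma>2} = {False}"
    using g by (auto split: if_splits)
  then show "measure (two_point \<gamma>1 \<gamma>2 p) {\<gamma>1} = p" "measure (two_point \<gamma>1 \<gamma>2 p) {\<gamma>2} = 1 - p"
    using g p unfolding two_point_def
    by (subst measure_distr; auto simp: singleton_sets_step_laws measure_pmf_single)+
qed

lemma measurable_walk_kernel:
  "(\<lambda>(w, X). walk_kernel w n X)
     \<in> measurable (PiM UNIV (\<lambda>_. step_laws) \<Otimes>\<^sub>M PiM {0..<n} (\<lambda>_. count_space UNIV))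
         (prob_algebra (count_space UNIV))"
proof (cases "n = 0")
  case True
  then show ?thesis
    by (auto simp: walk_kernel_def split_beta' space_prob_algebra prob_space_return)
next
  case False
  let ?M = "PiM UNIV (\<lambda>_::int ^ 'a. step_laws) \<Otimes>\<^sub>M PiM {0..<n} (\<lambda>_. count_space UNIV :: (int ^ 'a) measure)"
  have last: "(\<lambda>z. snd z (n - 1)) \<in> measurable ?M (count_space UNIV)"
    using False by (intro measurable_compose[OF measurable_snd] measurable_component_singleton) auto
  have "(\<lambda>z. distr (fst z y) (count_space UNIV) (\<lambda>e. y + e))
      \<in> measurable ?M (prob_algebra (count_space UNIV))" for y
  proof -
    have "(\<lambda>z. fst z y) \<in> measurable ?M (prob_algebra (count_space unit_steps))"
      using measurable_compose[OF measurable_fst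
        measurable_component_singleton[of y UNIV "\<lambda>_. step_laws"]]
      by (simp add: step_laws_def)
    then show ?thesis
      by (rule measurable_compose) (rule measurable_distr_prob_space, simp)
  qed
  from measurable_compose_countable[OF this last] show ?thesis
    using False by (simp add: walk_kernel_def split_beta')
qed

lemma Ionescu_Tulcea_walk_kernel:
  assumes "w \<in> space (PiM UNIV (\<lambda>_. step_laws))"
  shows "Ionescu_Tulcea (walk_kernel w) (\<lambda>_. count_space UNIV)"
proof -
  have K: "walk_kernel w n
      \<in> measurable (PiM {0..<n} (\<lambda>_. count_space UNIV)) (prob_algebra (count_space UNIV))" for n
    using measurable_compose[OF measurable_Pair1'[OF assms] measurable_walk_kernel[of n]] by simp
  show ?thesis
  proof (rule Ionescu_Tulcea.intro)
    show "walk_kernel w n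
        \<in> measurable (PiM {0..<n} (\<lambda>_. count_space UNIV)) (subprob_algebra (count_space UNIV))" for n
      by (rule measurable_prob_algebraD[OF K])
    show "prob_space (walk_kernel w n X)" if "X \<in> space (PiM {0..<n} (\<lambda>_. count_space UNIV))" for n X
      using measurable_space[OF K that] by (simp only: space_prob_algebra mem_Collect_eq)
  qed
qed

lemma measurable_walk_kernel_C:
  fixes undef :: "nat \<Rightarrow> int ^ 'd::finite"
  defines "undef \<equiv> \<lambda>_. undefined"
  shows "(\<lambda>w. Ionescu_Tulcea.C (walk_kernel w) (\<lambda>_. count_space UNIV) 0 n undef)
    \<in> measurable (PiM UNIV (\<lambda>_. step_laws)) (subprob_algebra (PiM {0..<n} (\<lambda>_. count_space UNIV)))"
proof (induction n)
  case 0
  have "return (PiM {0..<0} (\<lambda>_::nat. count_space UNIV)) undef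
      \<in> space (subprob_algebra (PiM {0..<0} (\<lambda>_::nat. count_space UNIV)))"
    by (auto simp: space_subprob_algebra undef_def PiM_empty
        intro!: prob_space_imp_subprob_space prob_space_return)
  from measurable_const[OF this] show ?case
    by (subst measurable_cong[OF Ionescu_Tulcea.C.simps(1)[OF Ionescu_Tulcea_walk_kernel]])
next
  case (Suc n)
  let ?N = "\<lambda>_::nat. count_space (UNIV :: (int ^ 'd) set)"
  let ?E = "PiM UNIV (\<lambda>_::int ^ 'd. step_laws)"
  let ?C = "\<lambda>n w. Ionescu_Tulcea.C (walk_kernel w) ?N 0 n undef"
  let ?eP = "\<lambda>w X. distr (walk_kernel w n X) (PiM {0..<Suc n} ?N) (fun_upd X n)"
  have eq: "?C (Suc n) w = ?C n w \<bind> ?eP w" if "w \<in> space ?E" for w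
  proof -
    interpret Ionescu_Tulcea "walk_kernel w" ?N
      by (rule Ionescu_Tulcea_walk_kernel[OF that])
    show ?thesis
      by (simp add: eP_def[abs_def])
  qed
  have "(\<lambda>w. ?C n w \<bind> ?eP w) \<in> measurable ?E (subprob_algebra (PiM {0..<Suc n} ?N))"
  proof (rule measurable_bind'[OF Suc])
    show "(\<lambda>(w, X). ?eP w X)
        \<in> measurable (?E \<Otimes>\<^sub>M PiM {0..<n} ?N) (subprob_algebra (PiM {0..<Suc n} ?N))"
      unfolding split_beta'
    proof (rule measurable_distr2)
      show "(\<lambda>z. walk_kernel (fst z) n (snd z))
          \<in> measurable (?E \<Otimes>\<^sub>M PiM {0..<n} ?N) (subprob_algebra (count_space UNIV))"
        using measurable_prob_algebraD[OF measurable_walk_kernel[of n]] by (simp add: split_beta')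
      show "(\<lambda>(x, y). (snd x)(n := y))
          \<in> measurable ((?E \<Otimes>\<^sub>M PiM {0..<n} ?N) \<Otimes>\<^sub>M count_space UNIV) (PiM {0..<Suc n} ?N)"
        unfolding split_beta'
        by (rule measurable_fun_upd[where J = "{0..<n}"])
          (auto intro: measurable_compose[OF measurable_fst measurable_snd] measurable_snd)
    qed
  qed
  then show ?case
    by (subst measurable_cong[OF eq])
qed

lemma sets_quenched_law:
  assumes "w \<in> space (PiM UNIV (\<lambda>_. step_laws))"
  shows "sets (quenched_law w) = sets path_space"
proof -
  interpret Ionescu_Tulcea "walk_kernel w" "\<lambda>_. count_space UNIV"
    by (rule Ionescu_Tulcea_walk_kernel[OF assms])
  show ?thesis
    by (simp add: quenched_law_def)
qed

lemma emeasure_quenched_law_emb: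
  fixes w :: "'d::finite env"
  assumes w: "w \<in> space (PiM UNIV (\<lambda>_. step_laws))"
    and J: "J \<subseteq> {0..<n}" and X: "X \<in> sets (PiM J (\<lambda>_. count_space UNIV))"
  shows "emeasure (quenched_law w) (prod_emb UNIV (\<lambda>_. count_space UNIV) J X) =
    emeasure (Ionescu_Tulcea.C (walk_kernel w) (\<lambda>_. count_space UNIV) 0 n (\<lambda>_. undefined))
      (prod_emb {0..<n} (\<lambda>_. count_space UNIV) J X)"
proof -
  interpret Ionescu_Tulcea "walk_kernel w" "\<lambda>_. count_space UNIV"
    by (rule Ionescu_Tulcea_walk_kernel[OF w])
  show ?thesis
    unfolding quenched_law_def using lim[of J X] J X emeasure_CI[OF J X]
    by (simp add: finite_subset)
qed

lemma prob_space_quenched_law: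
  fixes w :: "'d::finite env"
  assumes w: "w \<in> space (PiM UNIV (\<lambda>_. step_laws))"
  shows "prob_space (quenched_law w)"
proof -
  let ?N = "\<lambda>_::nat. count_space (UNIV :: (int ^ 'd) set)"
  interpret Ionescu_Tulcea "walk_kernel w" ?N
    by (rule Ionescu_Tulcea_walk_kernel[OF w])
  have "emeasure (quenched_law w) (prod_emb UNIV ?N {} {\<lambda>_. undefined}) =
      emeasure (C 0 0 (\<lambda>_. undefined)) (prod_emb {0..<0} ?N {} {\<lambda>_. undefined})"
    by (rule emeasure_quenched_law_emb[OF w]) (auto simp: PiM_empty)
  moreover have "prod_emb {0..<0} ?N {} {\<lambda>_. undefined} = {\<lambda>_. undefined}"
    by (auto simp: prod_emb_def)
  moreover have "prod_emb UNIV ?N {} {\<lambda>_. undefined} = UNIV"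
    by (auto simp: prod_emb_def)
  moreover have "space (quenched_law w) = UNIV"
    using sets_eq_imp_space_eq[OF sets_quenched_law[OF w]] by (simp add: space_PiM)
  ultimately show ?thesis
    by (intro prob_spaceI) (simp add: PiM_empty)
qed

lemma measurable_quenched_law:
  "quenched_law \<in> measurable (PiM UNIV (\<lambda>_. step_laws)) (prob_algebra path_space)"
proof (rule measurable_prob_algebra_generated[OF sets_PiM Int_stable_prod_algebra prod_algebra_sets_into_space])
  fix A :: "(nat \<Rightarrow> int ^ 'a) set"
  let ?N = "\<lambda>_::nat. count_space (UNIV :: (int ^ 'a) set)"
  assume "A \<in> prod_algebra UNIV ?N"
  then obtain J F where A: "A = prod_emb UNIV ?N J (Pi\<^sub>E J F)" "finite J"
    by (rule prod_algebraE)
  then have F: "Pi\<^sub>E J F \<in> sets (PiM J ?N)" by auto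
  obtain n where n: "J \<subseteq> {0..<n}"
    using A(2) by (metis finite_nat_iff_bounded lessThan_atLeast0)
  have "(\<lambda>w. emeasure (Ionescu_Tulcea.C (walk_kernel w) ?N 0 n (\<lambda>_. undefined))
      (prod_emb {0..<n} ?N J (Pi\<^sub>E J F))) \<in> borel_measurable (PiM UNIV (\<lambda>_. step_laws))"
    by (rule measurable_compose[OF measurable_walk_kernel_C measurable_emeasure_subprob_algebra])
      (rule measurable_prod_emb[OF n F])
  then show "(\<lambda>w. emeasure (quenched_law w) A) \<in> borel_measurable (PiM UNIV (\<lambda>_. step_laws))"
    unfolding A(1) by (subst measurable_cong[OF emeasure_quenched_law_emb[OF _ n F]])
qed (rule prob_space_quenched_law sets_quenched_law; assumption?)+

lemma sets_env_law:
  assumes "sets \<mu> = sets step_laws"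
  shows "sets (env_law \<mu>) = sets (PiM UNIV (\<lambda>_. step_laws))"
  unfolding env_law_def using assms by (intro sets_PiM_cong) auto

lemma prob_space_env_law:
  assumes "prob_space \<mu>"
  shows "prob_space (env_law \<mu>)"
  unfolding env_law_def using assms by (intro prob_space_PiM) auto

lemma env_law_in_prob_algebra:
  assumes "prob_space \<mu>" "sets \<mu> = sets step_laws"
  shows "env_law \<mu> \<in> space (prob_algebra (PiM UNIV (\<lambda>_. step_laws)))"
  using assms by (simp add: space_prob_algebra prob_space_env_law sets_env_law)

lemma
  assumes "prob_space \<mu>" "sets \<mu> = sets step_laws"
  shows prob_space_annealed_law: "prob_space (annealed_law \<mu>)"
    and sets_annealed_law: "sets (annealed_law \<mu>) = sets path_space"
  using prob_space_bind'[OF env_law_in_prob_algebra[OF assms] measurable_quenched_law]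
    sets_bind'[OF env_law_in_prob_algebra[OF assms] measurable_quenched_law]
  by (auto simp: annealed_law_def)

lemma emeasure_annealed_law:
  assumes "prob_space \<mu>" "sets \<mu> = sets step_laws" "A \<in> sets path_space"
  shows "emeasure (annealed_law \<mu>) A = (\<integral>\<^sup>+w. emeasure (quenched_law w) A \<partial>env_law \<mu>)"
  using emeasure_bind_prob_algebra[OF env_law_in_prob_algebra[OF assms(1,2)] measurable_quenched_law assms(3)]
  by (auto simp: annealed_law_def)

lemma emeasure_quenched_law_cylinder:
  assumes w: "w \<in> space (PiM UNIV (\<lambda>_. step_laws))"
  shows "emeasure (quenched_law w) {X. \<forall>k\<le>n. X k = x k} =
    (if x 0 = 0 then \<Prod>k<n. emeasure (w (x k)) {x (Suc k) - x k} else 0)"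
proof -
  let ?N = "\<lambda>_::nat. count_space (UNIV :: (int ^ 'a) set)"
  interpret Ionescu_Tulcea "walk_kernel w" ?N
    by (rule Ionescu_Tulcea_walk_kernel[OF w])
  have wy: "sets (w y) = Pow unit_steps" "space (w y) = unit_steps" for y
  proof -
    have "w y \<in> space step_laws"
      using w by (simp add: space_PiM PiE_iff)
    then show "sets (w y) = Pow unit_steps"
      by (simp add: space_step_laws)
    then show "space (w y) = unit_steps"
      using sets_eq_imp_space_eq[of "w y" "count_space unit_steps"] by simp
  qed
  have single: "{restrict x {0..<m}} \<in> sets (PiM {0..<m} ?N)" for m
    by (subst PiE_singleton[of "restrict x {0..<m}" "{0..<m}", symmetric]) auto
  let ?c = "\<lambda>m. emeasure (C 0 m (\<lambda>_. undefined)) {restrict x {0..<m}}"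
  have step: "?c (Suc m) = emeasure (walk_kernel w m (restrict x {0..<m})) {x m} * ?c m" for m
  proof -
    have "?c (Suc m) = (\<integral>\<^sup>+y. emeasure (eP m y) {restrict x {0..<Suc m}} \<partial>C 0 m (\<lambda>_. undefined))"
    proof -
      have "eP m \<in> measurable (C 0 m (\<lambda>_. undefined)) (subprob_algebra (PiM {0..<Suc m} ?N))"
        by (subst measurable_cong_sets[OF sets_C refl]) (simp_all add: measurable_eP)
      moreover have "space (C 0 m (\<lambda>_. undefined)) \<noteq> {}"
        by (rule prob_space.not_empty, rule prob_space_C) simp
      ultimately show ?thesis
        using emeasure_bind[OF _ _ single[of "Suc m"]] by simp
    qed
    also have "\<dots> = (\<integral>\<^sup>+y. emeasure (walk_kernel w m (restrict x {0..<m})) {x m} *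
        indicator {restrict x {0..<m}} y \<partial>C 0 m (\<lambda>_. undefined))"
    proof (rule nn_integral_cong)
      fix y assume "y \<in> space (C 0 m (\<lambda>_. undefined))"
      then have y: "y \<in> space (PiM {0..<m} ?N)" by (simp add: space_C)
      have "y(m := z) = restrict x {0..<Suc m} \<longleftrightarrow> y = restrict x {0..<m} \<and> z = x m" for z
      proof
        assume eq: "y(m := z) = restrict x {0..<Suc m}"
        have "y k = restrict x {0..<m} k" for k
        proof (cases "k < m")
          case True
          then show ?thesis using fun_cong[OF eq, of k] by simp
        next
          case False
          then show ?thesis using y by (simp add: space_PiM PiE_def extensional_def)
        qed
        then show "y = restrict x {0..<m} \<and> z = x m"
          using fun_cong[OF eq, of m] by auto
      qed (auto simp: fun_eq_iff)
      then have "(\<lambda>z. y(m := z)) -` {restrict x {0..<Suc m}} \<inter> space (?N m) =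
          (if y = restrict x {0..<m} then {x m} else {})"
        by (auto split: if_splits)
      then show "emeasure (eP m y) {restrict x {0..<Suc m}} =
          emeasure (walk_kernel w m (restrict x {0..<m})) {x m} * indicator {restrict x {0..<m}} y"
        using emeasure_eP[OF y single] by (auto split: split_indicator)
    qed
    also have "\<dots> = emeasure (walk_kernel w m (restrict x {0..<m})) {x m} * ?c m"
      by (rule nn_integral_cmult_indicator) (simp add: sets_C single)
    finally show ?thesis .
  qed
  have c: "?c (Suc m) = (if x 0 = 0 then \<Prod>k<m. emeasure (w (x k)) {x (Suc k) - x k} else 0)" for m
  proof (induction m)
    case 0
    have "?c 0 = 1"
      using single[of 0] by (simp add: emeasure_return fun_eq_iff)
    moreover have "emeasure (walk_kernel w 0 (restrict x {0..<0})) {x 0} = (if x 0 = 0 then 1 else 0)"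
      by (auto simp: walk_kernel_def)
    ultimately show ?case
      unfolding step[of 0] by simp
  next
    case (Suc m)
    have "emeasure (walk_kernel w (Suc m) (restrict x {0..<Suc m})) {x (Suc m)} =
        emeasure (w (x m)) ((\<lambda>e. x m + e) -` {x (Suc m)} \<inter> unit_steps)"
      by (auto simp: walk_kernel_def emeasure_distr wy measurable_def)
    also have "\<dots> = emeasure (w (x m)) {x (Suc m) - x m}"
    proof (cases "x (Suc m) - x m \<in> unit_steps")
      case True
      then have "(\<lambda>e. x m + e) -` {x (Suc m)} \<inter> unit_steps = {x (Suc m) - x m}"
        by (auto simp: algebra_simps)
      then show ?thesis by simp
    next
      case False
      have "x (Suc m) - x m = e" if "x m + e = x (Suc m)" for e
        using that by (metis add_diff_cancel_left')
      with False have *: "(\<lambda>e. x m + e) -` {x (Suc m)} \<inter> unit_steps = {}"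
        by auto
      show ?thesis
        unfolding * using False by (simp add: emeasure_notin_sets wy)
    qed
    finally show ?case
      unfolding step[of "Suc m"] Suc by (simp add: mult.commute)
  qed
  have "emeasure (quenched_law w) (PF.emb UNIV {0..<Suc n} {restrict x {0..<Suc n}}) = ?c (Suc n)"
    by (subst emeasure_quenched_law_emb[OF w order_refl single])
      (simp add: prod_emb_id single sets.sets_into_space[OF single, unfolded space_PiM] del: C.simps)
  moreover have "PF.emb UNIV {0..<Suc n} {restrict x {0..<Suc n}} = {X. \<forall>k\<le>n. X k = x k}"
    by (auto simp: prod_emb_def space_PiM fun_eq_iff restrict_def less_Suc_eq_le split: if_splits)
  ultimately show ?thesis
    using c[of n] by simp
qed

lemma measurable_convergence_event:
  "{X \<in> space path_space. (\<lambda>n. inverse (real n) *\<^sub>R real_vec (X n)) \<longlonglongrightarrow> v} \<in> sets path_space"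
proof -
  have "(\<lambda>X. real_vec (X n)) \<in> borel_measurable path_space" for n
    by (rule measurable_compose[OF measurable_component_singleton[of n]]) auto
  then show ?thesis
    by (intro predE measurable_limit) measurable
qed

end

theory Submission
  imports Defs
begin

text \<open>Label the sites by i.i.d. uniform variables, and let a site be of type 1 if its label is below
  \<open>p\<close>. Let the walk take its steps from two independent i.i.d. stacks, one for each type: the
  \<open>k\<close>-th step from type 1 sites is the \<open>k\<close>-th entry of the first stack, and likewise for type 2.
  The position of the walk is then determined by how many steps it has taken from each
  type. Use the same labels and stacks for \<open>p \<le> q\<close>. Whenever the two walks have taken the same
  number of steps from type 1 at the same time, they are at the same site, which is of type 1 for
  \<open>q\<close> if it is for \<open>p\<close>. Hence the number of type 1 steps up to any time is monotone in
  \<open>p\<close> on the coupling. The expected position is an affine function of the expected number of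
  type 1 steps, with coefficients that do not depend on \<open>p\<close>; now divide by the time and let it tend to
  infinity.\<close>

subsection \<open>Walks driven by stacks\<close>

text \<open>Overwriting coordinate \<open>j\<close> by an independent draw from \<open>M j\<close>
  preserves the product measure. The factor \<open>f\<close> does not see this change and
  \<open>h\<close> sees only the new value, so Fubini splits the integral. This is the only
  independence statement on which the analysis of the walk rests.\<close>

lemma integral_PiM_component_mult:
  fixes f :: "('i \<Rightarrow> 'a) \<Rightarrow> real" and h :: "'a \<Rightarrow> real"
  assumes M: "\<And>i. prob_space (M i)"
    and f [measurable]: "f \<in> borel_measurable (PiM UNIV M)" and f_le: "\<And>\<xi>. \<bar>f \<xi>\<bar> \<le> A"
    and h [measurable]: "h \<in> borel_measurable (M j)" and h_le: "\<And>y. y \<in> space (M j) \<Longrightarrow> \<bar>h y\<bar> \<le> B"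
    and inv: "\<And>\<xi> y. f (\<xi>(j := y)) = f \<xi>"
  shows "(\<integral>\<xi>. f \<xi> * h (\<xi> j) \<partial>PiM UNIV M) = (\<integral>\<xi>. f \<xi> \<partial>PiM UNIV M) * (\<integral>y. h y \<partial>M j)"
proof -
  interpret P: prob_space "PiM UNIV M"
    using M by (intro prob_space_PiM)
  interpret Mj: prob_space "M j"
    by (rule M)
  interpret PP: pair_prob_space "M j" "PiM UNIV M" ..
  have upd [measurable]: "(\<lambda>(x, X). X(j := x)) \<in> M j \<Otimes>\<^sub>M PiM UNIV M \<rightarrow>\<^sub>M PiM UNIV M"
    unfolding split_beta' by (rule measurable_fun_upd[where J = UNIV]) auto
  have D: "distr (M j \<Otimes>\<^sub>M PiM UNIV M) (PiM UNIV M) (\<lambda>(x, X). X(j := x)) = PiM UNIV M"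
    using distr_pair_PiM_eq_PiM[of UNIV M j] M by simp
  have B0: "0 \<le> B"
    using Mj.not_empty h_le by force
  have "(\<integral>\<xi>. f \<xi> * h (\<xi> j) \<partial>PiM UNIV M) =
      (\<integral>\<xi>. f \<xi> * h (\<xi> j) \<partial>distr (M j \<Otimes>\<^sub>M PiM UNIV M) (PiM UNIV M) (\<lambda>(x, X). X(j := x)))"
    by (simp only: D)
  also have "\<dots> = (\<integral>z. h (fst z) * f (snd z) \<partial>(M j \<Otimes>\<^sub>M PiM UNIV M))"
    by (subst integral_distr) (auto simp: inv split_beta' mult.commute)
  also have "\<dots> = (\<integral>x. \<integral>\<xi>. h (fst (x, \<xi>)) * f (snd (x, \<xi>)) \<partial>PiM UNIV M \<partial>M j)"
  proof (rule PP.integral_fst'[symmetric])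
    have "\<bar>h (fst z) * f (snd z)\<bar> \<le> B * A" if "z \<in> space (M j \<Otimes>\<^sub>M PiM UNIV M)" for z
      unfolding abs_mult using that f_le h_le B0
      by (intro mult_mono) (auto simp: space_pair_measure)
    then show "integrable (M j \<Otimes>\<^sub>M PiM UNIV M) (\<lambda>z. h (fst z) * f (snd z))"
      by (intro PP.integrable_const_bound[where B = "B * A"]) auto
  qed
  finally show ?thesis by (simp add: mult.commute)
qed

section \<open>Stack walks and their monotonicity in the types\<close>

definition stack_law :: "(bool \<Rightarrow> 'a measure) \<Rightarrow> (bool \<times> nat \<Rightarrow> 'a) measure" where
  "stack_law \<gamma> = PiM UNIV (\<lambda>j. \<gamma> (fst j))"

text \<open>The state consists of the position and the number of entries removed so far from each stack.\<close>

primrec stack_walk ::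
  "('a::monoid_add \<Rightarrow> bool) \<Rightarrow> (bool \<times> nat \<Rightarrow> 'a) \<Rightarrow> nat \<Rightarrow> 'a \<times> (bool \<Rightarrow> nat)" where
  "stack_walk t \<xi> 0 = (0, \<lambda>_. 0)"
| "stack_walk t \<xi> (Suc n) =
    (case stack_walk t \<xi> n of (x, c) \<Rightarrow> (x + \<xi> (t x, c (t x)), c(t x := Suc (c (t x)))))"

definition pos :: "('a::monoid_add \<Rightarrow> bool) \<Rightarrow> (bool \<times> nat \<Rightarrow> 'a) \<Rightarrow> nat \<Rightarrow> 'a" where
  "pos t \<xi> n = fst (stack_walk t \<xi> n)"

definition used :: "('a::monoid_add \<Rightarrow> bool) \<Rightarrow> (bool \<times> nat \<Rightarrow> 'a) \<Rightarrow> nat \<Rightarrow> bool \<Rightarrow> nat" where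
  "used t \<xi> n = snd (stack_walk t \<xi> n)"

text \<open>The address of the entry that the step from time \<open>n\<close> to
  \<open>n + 1\<close> consumes. Separating the address from the value stored there makes it
  possible to fix the former and resample the latter.\<close>

definition top_entry :: "('a::monoid_add \<Rightarrow> bool) \<Rightarrow> (bool \<times> nat \<Rightarrow> 'a) \<Rightarrow> nat \<Rightarrow> bool \<times> nat" where
  "top_entry t \<xi> n = (t (pos t \<xi> n), used t \<xi> n (t (pos t \<xi> n)))"

lemma pos_0 [simp]: "pos t \<xi> 0 = 0"
  and used_0 [simp]: "used t \<xi> 0 b = 0"
  and pos_Suc: "pos t \<xi> (Suc n) = pos t \<xi> n + \<xi> (top_entry t \<xi> n)"
  and used_Suc: "used t \<xi> (Suc n) b = used t \<xi> n b + of_bool (t (pos t \<xi> n) = b)"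
  by (auto simp: pos_def used_def top_entry_def split_beta')

lemma used_add: "used t \<xi> n True + used t \<xi> n False = n"
  by (induction n) (auto simp: used_Suc)

text \<open>Since addition commutes, the order in which the two stacks are interleaved is
  irrelevant. Two walks with different types but equal counts are therefore at the same
  site.\<close>

lemma pos_eq_sum:
  fixes \<xi> :: "bool \<times> nat \<Rightarrow> 'a::comm_monoid_add"
  shows "pos t \<xi> n = (\<Sum>m<used t \<xi> n True. \<xi> (True, m)) + (\<Sum>m<used t \<xi> n False. \<xi> (False, m))"
  by (induction n) (auto simp: pos_Suc used_Suc top_entry_def algebra_simps)

text \<open>The order could only be lost at a time when the two counts agree. The walks are then at
  a common site, and the hypothesis on the types forces \<open>t'\<close> to count whenever
  \<open>t\<close> does.\<close>

lemma used_mono: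
  fixes \<xi> :: "bool \<times> nat \<Rightarrow> 'a::comm_monoid_add"
  assumes "\<And>x. t x \<Longrightarrow> t' x"
  shows "used t \<xi> n True \<le> used t' \<xi> n True"
proof (induction n)
  case (Suc n)
  show ?case
  proof (cases "used t \<xi> n True = used t' \<xi> n True")
    case True
    moreover from this have "used t \<xi> n False = used t' \<xi> n False"
      using used_add[of t \<xi> n] used_add[of t' \<xi> n] by simp
    ultimately have "pos t \<xi> n = pos t' \<xi> n"
      by (simp add: pos_eq_sum)
    with True assms show ?thesis
      by (simp add: used_Suc)
  next
    \<comment> \<open>The count for \<open>t\<close> is strictly behind and grows by at most one, so
      it cannot overtake.\<close>
    case False
    with Suc show ?thesis
      by (simp add: used_Suc)
  qed
qed simp

section \<open>Entries are read only once; resampling an entry\<close>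

lemma used_mono_time: "l \<le> n \<Longrightarrow> used t \<xi> l b \<le> used t \<xi> n b"
  by (induction n rule: dec_induct) (auto simp: used_Suc)

text \<open>Reading an entry raises the counter of its stack above the index of that entry, and
  counters never decrease. Hence no address recurs.\<close>

lemma inj_top_entry: "l < n \<Longrightarrow> top_entry t \<xi> l \<noteq> top_entry t \<xi> n"
  using used_mono_time[of "Suc l" n t \<xi> "t (pos t \<xi> l)"]
  by (cases "t (pos t \<xi> l)"; cases "t (pos t \<xi> n)") (auto simp: top_entry_def used_Suc)

text \<open>It suffices to compare the stacks at the addresses visited under \<xi>: as long as the
  states coincide, the other walk reads the same addresses.\<close>

lemma stack_walk_cong:
  assumes "\<And>k. k < n \<Longrightarrow> \<xi> (top_entry t \<xi> k) = \<xi>' (top_entry t \<xi> k)"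
  shows "l \<le> n \<Longrightarrow> stack_walk t \<xi> l = stack_walk t \<xi>' l"
proof (induction l)
  case (Suc l)
  with assms[of l] show ?case
    by (auto simp: top_entry_def pos_def used_def split_beta')
qed simp

text \<open>An entry read at time \<open>n\<close> has not been read before, so its value has no
  influence on the walk up to time \<open>n\<close>.\<close>

lemma stack_walk_upd:
  assumes "top_entry t \<xi> n = j" "l \<le> n"
  shows "stack_walk t (\<xi>(j := y)) l = stack_walk t \<xi> l"
  using assms inj_top_entry[of _ n t \<xi>]
  by (intro stack_walk_cong[of n \<xi> t "\<xi>(j := y)", symmetric]) auto

lemma top_entry_upd_iff: "top_entry t (\<xi>(j := y)) n = j \<longleftrightarrow> top_entry t \<xi> n = j"
proof -
  have "top_entry t (\<xi>(j := y)) n = j" if "top_entry t \<xi> n = j" for \<xi> :: "bool \<times> nat \<Rightarrow> 'a" and y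
    using stack_walk_upd[OF that order_refl, of y] that by (simp add: top_entry_def pos_def used_def)
  \<comment> \<open>The converse direction puts the old value back: overwriting entry
    \<open>j\<close> once more by \<open>\<xi> j\<close> recovers \<xi>.\<close>
  from this[of \<xi> y] this[of "\<xi>(j := y)" "\<xi> j"] show ?thesis by auto
qed

text \<open>Confines the random address to a finite set, so that integrals can be decomposed as
  finite sums over its possible values.\<close>

lemma top_entry_le: "top_entry t \<xi> n \<in> UNIV \<times> {..n}"
  using used_add[of t \<xi> n] by (cases "t (pos t \<xi> n)") (auto simp: top_entry_def)

text \<open>The types may depend on the sample point because in the coupling they come from random
  labels. The state space is countable, so it suffices to check one step from each fixed
  state.\<close>

lemma measurable_stack_walk:
  fixes t :: "'m \<Rightarrow> 'a::{monoid_add, countable} \<Rightarrow> bool"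
  assumes t [measurable]: "\<And>x. Measurable.pred M (\<lambda>m. t m x)"
    and \<xi> [measurable]: "\<And>j. (\<lambda>m. \<xi> m j) \<in> M \<rightarrow>\<^sub>M count_space UNIV"
  shows "(\<lambda>m. stack_walk (t m) (\<xi> m) n) \<in> M \<rightarrow>\<^sub>M count_space UNIV"
proof (induction n)
  case (Suc n)
  have "(\<lambda>m. case s of (x, c) \<Rightarrow> (x + \<xi> m (t m x, c (t m x)), c(t m x := Suc (c (t m x)))))
      \<in> M \<rightarrow>\<^sub>M count_space UNIV" for s
  proof (cases s)
    case (Pair x c)
    have comp: "(\<lambda>m. (x + \<xi> m j, c')) \<in> M \<rightarrow>\<^sub>M count_space UNIV" for j and c' :: "bool \<Rightarrow> nat"
      by (rule measurable_compose[OF \<xi>[of j], where g = "\<lambda>y. (x + y, c')"]) simp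
    have "(\<lambda>m. if t m x then (x + \<xi> m (True, c True), c(True := Suc (c True)))
        else (x + \<xi> m (False, c False), c(False := Suc (c False)))) \<in> M \<rightarrow>\<^sub>M count_space UNIV"
      by (rule measurable_If[OF comp comp predE[OF t]])
    moreover have "(\<lambda>m. (x + \<xi> m (t m x, c (t m x)), c(t m x := Suc (c (t m x))))) =
      (\<lambda>m. if t m x then (x + \<xi> m (True, c True), c(True := Suc (c True)))
        else (x + \<xi> m (False, c False), c(False := Suc (c False))))"
      by (rule ext) (simp split: if_split)
    ultimately show ?thesis
      unfolding Pair prod.case by metis
  qed
  from measurable_compose_countable[OF this Suc] show ?case
    unfolding stack_walk.simps .
qed simp

lemma
  fixes t :: "'m \<Rightarrow> 'a::{monoid_add, countable} \<Rightarrow> bool"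
  assumes "\<And>x. Measurable.pred M (\<lambda>m. t m x)" "\<And>j. (\<lambda>m. \<xi> m j) \<in> M \<rightarrow>\<^sub>M count_space UNIV"
  shows measurable_pos: "(\<lambda>m. pos (t m) (\<xi> m) n) \<in> M \<rightarrow>\<^sub>M count_space UNIV"
    and measurable_used: "(\<lambda>m. used (t m) (\<xi> m) n) \<in> M \<rightarrow>\<^sub>M count_space UNIV"
    and measurable_top_entry: "(\<lambda>m. top_entry (t m) (\<xi> m) n) \<in> M \<rightarrow>\<^sub>M count_space UNIV"
proof -
  note s = measurable_stack_walk[OF assms, where n = n]
  show "(\<lambda>m. pos (t m) (\<xi> m) n) \<in> M \<rightarrow>\<^sub>M count_space UNIV"
    unfolding pos_def by (rule measurable_compose[OF s, where g = fst]) simp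
  show "(\<lambda>m. used (t m) (\<xi> m) n) \<in> M \<rightarrow>\<^sub>M count_space UNIV"
    unfolding used_def by (rule measurable_compose[OF s, where g = snd]) simp
  have "(\<lambda>m. (t m (fst z), snd z (t m (fst z)))) \<in> M \<rightarrow>\<^sub>M count_space UNIV" for z :: "'a \<times> (bool \<Rightarrow> nat)"
    by (rule measurable_compose[OF assms(1)[of "fst z"], where g = "\<lambda>b. (b, snd z b)"]) simp
  from measurable_compose_countable[OF this s]
  show "(\<lambda>m. top_entry (t m) (\<xi> m) n) \<in> M \<rightarrow>\<^sub>M count_space UNIV"
    unfolding top_entry_def pos_def used_def .
qed

lemma
  assumes "\<gamma> \<in> space step_laws"
  shows sets_step_law: "sets \<gamma> = Pow unit_steps" and space_step_law: "space \<gamma> = unit_steps"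
    and prob_space_step_law: "prob_space \<gamma>"
  using assms sets_eq_imp_space_eq[of \<gamma> "count_space unit_steps"] by (auto simp: space_step_laws)

subsection \<open>The quenched law\<close>

lemma unit_steps_component_le: "y \<in> unit_steps \<Longrightarrow> \<bar>real_of_int (y $ i)\<bar> \<le> 1"
  by (auto simp: unit_steps_def axis_def)

lemma sets_path_cylinder: "{X. \<forall>k\<le>n. X k = x k} \<in> sets path_space"
proof -
  have "{X \<in> space path_space. \<forall>k\<le>n. X k = x k} \<in> sets path_space"
    by measurable
  then show ?thesis
    by (simp add: space_PiM)
qed

text \<open>An initial segment of a path takes countably many values, so its law is determined by
  the cylinders around single paths. Every finite-dimensional product set is an event about some
  initial segment.\<close>

lemma path_law_eqI:
  fixes M N :: "(nat \<Rightarrow> int ^ 'd::finite) measure"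
  assumes sets_M: "sets M = sets path_space" and sets_N: "sets N = sets path_space"
    and fin: "finite_measure M"
    and cyl: "\<And>n x. emeasure M {X. \<forall>k\<le>n. X k = x k} = emeasure N {X. \<forall>k\<le>n. X k = x k}"
  shows "M = N"
proof (rule measure_eqI_PiM_infinite[OF sets_M sets_N _ fin])
  fix A :: "nat \<Rightarrow> (int ^ 'd) set" and J :: "nat set"
  assume "finite J"
  then obtain n where n: "J \<subseteq> {..n}"
    using finite_nat_set_iff_bounded_le by auto
  then have le: "j \<le> n" if "j \<in> J" for j
    using that by auto
  \<comment> \<open>Initial segments are represented as functions that are \<open>undefined\<close>
    beyond \<open>n\<close>; this makes the set of them countable.\<close>
  define E where "E = (PiE {..n} (\<lambda>_. UNIV) :: (nat \<Rightarrow> int ^ 'd) set)"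
  have E: "countable E"
    unfolding E_def by (intro countable_PiE) auto
  have sp: "space L = UNIV" if "sets L = sets (path_space :: (nat \<Rightarrow> int ^ 'd) measure)" for L
    using sets_eq_imp_space_eq[OF that] by (simp add: space_PiM)
  have vim: "(\<lambda>X. restrict X {..n}) -` {a} = {X. \<forall>k\<le>n. X k = a k}" if "a \<in> E" for a
    using that by (auto simp: E_def PiE_def extensional_def restrict_def fun_eq_iff)
  have meas: "(\<lambda>X. restrict X {..n}) \<in> L \<rightarrow>\<^sub>M count_space E"
    if "sets L = sets (path_space :: (nat \<Rightarrow> int ^ 'd) measure)" for L
    using that vim by (subst measurable_count_space_eq_countable[OF E])
      (auto simp: sp E_def sets_path_cylinder)
  have D: "distr M (count_space E) (\<lambda>X. restrict X {..n}) = distr N (count_space E) (\<lambda>X. restrict X {..n})"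
  proof (rule measure_eqI_countable[OF _ _ E])
    fix a assume "a \<in> E"
    then show "emeasure (distr M (count_space E) (\<lambda>X. restrict X {..n})) {a} =
        emeasure (distr N (count_space E) (\<lambda>X. restrict X {..n})) {a}"
      by (simp add: emeasure_distr meas sets_M sets_N vim sp cyl)
  qed auto
  have "prod_emb UNIV (\<lambda>_. count_space UNIV) J (Pi\<^sub>E J A) =
      (\<lambda>X. restrict X {..n}) -` {X \<in> E. \<forall>j\<in>J. X j \<in> A j}"
    using le by (auto simp: prod_emb_def E_def)
  then show "emeasure M (prod_emb UNIV (\<lambda>_. count_space UNIV) J (Pi\<^sub>E J A)) =
      emeasure N (prod_emb UNIV (\<lambda>_. count_space UNIV) J (Pi\<^sub>E J A))"
    using arg_cong[OF D, of "\<lambda>L. emeasure L {X \<in> E. \<forall>j\<in>J. X j \<in> A j}"]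
    by (simp add: emeasure_distr meas sets_M sets_N sp)
qed

section \<open>The stack walk in a fixed configuration of types\<close>

context
  fixes \<gamma> :: "bool \<Rightarrow> (int ^ 'd::finite) measure"
  assumes \<gamma>: "\<And>b. \<gamma> b \<in> space step_laws"
begin

lemma prob_space_stack_law: "prob_space (stack_law \<gamma>)"
  unfolding stack_law_def using \<gamma> by (intro prob_space_PiM prob_space_step_law)

lemma space_stack_law: "\<xi> \<in> space (stack_law \<gamma>) \<longleftrightarrow> (\<forall>j. \<xi> j \<in> unit_steps)"
  unfolding stack_law_def using \<gamma> by (auto simp: space_PiM PiE_iff space_step_law)

lemma measurable_stack_component:
  "(\<lambda>\<xi>. \<xi> j) \<in> stack_law \<gamma> \<rightarrow>\<^sub>M count_space UNIV"
proof -
  have "(\<lambda>\<xi>. \<xi> j) \<in> stack_law \<gamma> \<rightarrow>\<^sub>M \<gamma> (fst j)"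
    unfolding stack_law_def by simp
  moreover have "(\<lambda>x. x) \<in> \<gamma> (fst j) \<rightarrow>\<^sub>M count_space UNIV"
    using \<gamma> by (auto simp: measurable_def space_step_law sets_step_law)
  ultimately show ?thesis
    by (rule measurable_compose)
qed

lemmas measurable_stack_law [measurable] =
  measurable_pos[OF measurable_const measurable_stack_component, simplified]
  measurable_used[OF measurable_const measurable_stack_component, simplified]
  measurable_top_entry[OF measurable_const measurable_stack_component, simplified]
  measurable_stack_component

text \<open>The entry read at time \<open>n\<close> is independent of the walk up to that time: on the event that this is
  entry \<open>j\<close>, resampling entry \<open>j\<close> changes neither the event nor the walk up to time \<open>n\<close>.\<close>

lemma integral_fresh_step:
  fixes f :: "(bool \<times> nat \<Rightarrow> int ^ 'd) \<Rightarrow> real" and h :: "int ^ 'd \<Rightarrow> real"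
  assumes f [measurable]: "f \<in> borel_measurable (stack_law \<gamma>)" and f_le: "\<And>\<xi>. \<bar>f \<xi>\<bar> \<le> A"
    and cong: "\<And>\<xi> \<xi>'. (\<And>l. l \<le> n \<Longrightarrow> stack_walk t \<xi> l = stack_walk t \<xi>' l) \<Longrightarrow> f \<xi> = f \<xi>'"
    and h_le: "\<And>y. y \<in> unit_steps \<Longrightarrow> \<bar>h y\<bar> \<le> B"
  shows "(\<integral>\<xi>. f \<xi> * h (\<xi> (top_entry t \<xi> n)) \<partial>stack_law \<gamma>) =
    (\<integral>\<xi>. f \<xi> * (\<integral>y. h y \<partial>\<gamma> (t (pos t \<xi> n))) \<partial>stack_law \<gamma>)"
proof -
  interpret prob_space "stack_law \<gamma>"
    by (rule prob_space_stack_law)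
  let ?J = "UNIV \<times> {..n} :: (bool \<times> nat) set"
  let ?g = "\<lambda>j \<xi>. f \<xi> * of_bool (top_entry t \<xi> n = j)"
  have g [measurable]: "?g j \<in> borel_measurable (stack_law \<gamma>)" for j
    by measurable
  have h [measurable]: "(\<lambda>\<xi>. h (\<xi> j)) \<in> borel_measurable (stack_law \<gamma>)" for j
    by (rule measurable_compose[OF measurable_stack_component]) simp
  have g_le: "\<bar>?g j \<xi>\<bar> \<le> A" for j \<xi>
    using f_le[of \<xi>] by auto
  \<comment> \<open>Exactly one address is the one read at time \<open>n\<close>. Summing over the
    possible addresses replaces the random address by a fixed \<open>j\<close> in each term.\<close>
  have J: "(\<Sum>j\<in>?J. ?g j \<xi> * k j) = f \<xi> * k (top_entry t \<xi> n)" for \<xi> k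
  proof -
    have "(\<Sum>j\<in>?J. ?g j \<xi> * k j) = (\<Sum>j\<in>?J. if j = top_entry t \<xi> n then f \<xi> * k j else 0)"
      by (intro sum.cong) auto
    also have "\<dots> = f \<xi> * k (top_entry t \<xi> n)"
      using top_entry_le[of t \<xi> n] by (subst sum.delta) auto
    finally show ?thesis .
  qed
  have int: "integrable (stack_law \<gamma>) (\<lambda>\<xi>. ?g j \<xi> * h (\<xi> j))" for j
  proof (rule integrable_const_bound[where B = "A * B"])
    show "AE \<xi> in stack_law \<gamma>. norm (?g j \<xi> * h (\<xi> j)) \<le> A * B"
      unfolding real_norm_def abs_mult[of "?g j _"]
      by (intro AE_I2 mult_mono g_le h_le order_trans[OF abs_ge_zero f_le]) (simp_all add: space_stack_law del: split_paired_All)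
  qed measurable
  have int': "integrable (stack_law \<gamma>) (\<lambda>\<xi>. ?g j \<xi> * c)" for j c
    by (intro integrable_mult_left integrable_const_bound[where B = A]) (use g_le in auto)
  have eq: "(\<integral>\<xi>. ?g j \<xi> * h (\<xi> j) \<partial>stack_law \<gamma>) = (\<integral>\<xi>. ?g j \<xi> * (\<integral>y. h y \<partial>\<gamma> (fst j)) \<partial>stack_law \<gamma>)" for j
  proof -
    \<comment> \<open>If \<open>j\<close> is the address read at time \<open>n\<close>, the walk up
      to that time is unchanged by the update; otherwise the indicator vanishes before and after
      it.\<close>
    have inv: "?g j (\<xi>(j := y)) = ?g j \<xi>" for \<xi> y
      using cong[of "\<xi>(j := y)" \<xi>] stack_walk_upd[of t \<xi> n j _ y]
      by (cases "top_entry t \<xi> n = j") (auto simp: top_entry_upd_iff)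
    have "h \<in> borel_measurable (\<gamma> (fst j))"
      using \<gamma> by (auto simp: measurable_def space_step_law sets_step_law)
    then show ?thesis
      unfolding stack_law_def using h_le
      by (subst integral_PiM_component_mult[where A = A and B = B])
        (auto simp: \<gamma> prob_space_step_law space_step_law inv g_le g[unfolded stack_law_def])
  qed
  have "(\<integral>\<xi>. f \<xi> * h (\<xi> (top_entry t \<xi> n)) \<partial>stack_law \<gamma>) =
      (\<integral>\<xi>. (\<Sum>j\<in>?J. ?g j \<xi> * h (\<xi> j)) \<partial>stack_law \<gamma>)"
    by (simp only: J)
  also have "\<dots> = (\<integral>\<xi>. (\<Sum>j\<in>?J. ?g j \<xi> * (\<integral>y. h y \<partial>\<gamma> (fst j))) \<partial>stack_law \<gamma>)"
    by (subst (1 2) Bochner_Integration.integral_sum) (intro int int' sum.cong eq refl)+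
  also have "\<dots> = (\<integral>\<xi>. f \<xi> * (\<integral>y. h y \<partial>\<gamma> (t (pos t \<xi> n))) \<partial>stack_law \<gamma>)"
    by (simp only: J) (simp add: top_entry_def)
  finally show ?thesis .
qed

lemma integral_of_bool_singleton:
  "(\<integral>y. (of_bool (y = d) :: real) \<partial>\<gamma> b) = measure (\<gamma> b) {d}"
proof (cases "d \<in> unit_steps")
  case True
  have "(\<integral>y. (of_bool (y = d) :: real) \<partial>\<gamma> b) = (\<integral>y. indicator {d} y \<partial>\<gamma> b)"
    by (intro Bochner_Integration.integral_cong) (auto simp: indicator_def)
  with True \<gamma> show ?thesis
    by (simp add: space_step_law)
next
  \<comment> \<open>A singleton outside \<open>unit_steps\<close> is not measurable for
    \<open>\<gamma> b\<close> and has measure 0 by convention, which agrees with the vanishing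
    integral.\<close>
  case False
  then have "(\<integral>y. (of_bool (y = d) :: real) \<partial>\<gamma> b) = (\<integral>y. 0 \<partial>\<gamma> b)"
    using \<gamma> by (intro Bochner_Integration.integral_cong) (auto simp: space_step_law)
  with False \<gamma> show ?thesis
    by (simp add: measure_notin_sets sets_step_law)
qed

text \<open>The cylinder at time \<open>n + 1\<close> is the cylinder at time \<open>n\<close>
  together with a prescribed value of the next step. That step is a fresh entry, so the Markov
  product formula follows by induction.\<close>

lemma measure_pos_cylinder:
  "measure (stack_law \<gamma>) {\<xi> \<in> space (stack_law \<gamma>). \<forall>k\<le>n. pos t \<xi> k = x k} =
    (if x 0 = 0 then \<Prod>k<n. measure (\<gamma> (t (x k))) {x (Suc k) - x k} else 0)"
proof (induction n)
  case 0
  interpret prob_space "stack_law \<gamma>"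
    by (rule prob_space_stack_law)
  show ?case
    by (auto simp: prob_space)
next
  case (Suc n)
  let ?f = "\<lambda>n \<xi>. of_bool (\<forall>k\<le>n. pos t \<xi> k = x k) :: real"
  let ?h = "\<lambda>y. of_bool (y = x (Suc n) - x n) :: real"
  have C: "measure (stack_law \<gamma>) {\<xi> \<in> space (stack_law \<gamma>). \<forall>k\<le>m. pos t \<xi> k = x k} =
      (\<integral>\<xi>. ?f m \<xi> \<partial>stack_law \<gamma>)" for m
  proof -
    have "(\<integral>\<xi>. ?f m \<xi> \<partial>stack_law \<gamma>) =
        (\<integral>\<xi>. indicator {\<xi> \<in> space (stack_law \<gamma>). \<forall>k\<le>m. pos t \<xi> k = x k} \<xi> \<partial>stack_law \<gamma>)"
      by (intro Bochner_Integration.integral_cong) (auto simp: indicator_def)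
    then show ?thesis
      by (simp add: Int_absorb2)
  qed
  have "(\<integral>\<xi>. ?f (Suc n) \<xi> \<partial>stack_law \<gamma>) = (\<integral>\<xi>. ?f n \<xi> * ?h (\<xi> (top_entry t \<xi> n)) \<partial>stack_law \<gamma>)"
  proof (intro Bochner_Integration.integral_cong refl)
    fix \<xi>
    have "(\<forall>k\<le>Suc n. pos t \<xi> k = x k) \<longleftrightarrow>
        (\<forall>k\<le>n. pos t \<xi> k = x k) \<and> \<xi> (top_entry t \<xi> n) = x (Suc n) - x n"
      unfolding eq_diff_eq add.commute[of _ "x n"] by (auto simp: le_Suc_eq all_conj_distrib pos_Suc)
    then show "?f (Suc n) \<xi> = ?f n \<xi> * ?h (\<xi> (top_entry t \<xi> n))"
      by simp
  qed
  also have "\<dots> = (\<integral>\<xi>. ?f n \<xi> * (\<integral>y. ?h y \<partial>\<gamma> (t (pos t \<xi> n))) \<partial>stack_law \<gamma>)"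
  proof (rule integral_fresh_step[where A = 1 and B = 1])
    show "?f n \<xi> = ?f n \<xi>'" if "\<And>l. l \<le> n \<Longrightarrow> stack_walk t \<xi> l = stack_walk t \<xi>' l" for \<xi> \<xi>'
      using that by (simp add: pos_def)
    show "?f n \<in> borel_measurable (stack_law \<gamma>)"
      by measurable
  qed simp_all
  \<comment> \<open>On the cylinder the walk is at \<open>x n\<close> at time \<open>n\<close>, so
    the type that governs the next step is no longer random.\<close>
  also have "\<dots> = (\<integral>\<xi>. ?f n \<xi> * measure (\<gamma> (t (x n))) {x (Suc n) - x n} \<partial>stack_law \<gamma>)"
    by (intro Bochner_Integration.integral_cong refl) (auto simp: integral_of_bool_singleton)
  finally show ?case
    using Suc unfolding C by simp
qed

lemma measurable_pos_path: "pos t \<in> stack_law \<gamma> \<rightarrow>\<^sub>M path_space"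
  by (rule measurable_PiM_single') (auto simp: space_PiM)

lemma types_env: "(\<lambda>x. \<gamma> (t x)) \<in> space (PiM UNIV (\<lambda>_. step_laws))"
  using \<gamma> by (simp add: space_PiM PiE_iff)

text \<open>The two laws have the same cylinder probabilities. The law of the stacks is the same for
  every \<open>t\<close>, so a single source of randomness drives the walks in all
  environments.\<close>

lemma quenched_law_eq_distr: "quenched_law (\<lambda>x. \<gamma> (t x)) = distr (stack_law \<gamma>) path_space (pos t)"
proof (rule path_law_eqI)
  interpret S: prob_space "stack_law \<gamma>"
    by (rule prob_space_stack_law)
  interpret Q: prob_space "quenched_law (\<lambda>x. \<gamma> (t x))"
    by (rule prob_space_quenched_law[OF types_env])
  show "sets (quenched_law (\<lambda>x. \<gamma> (t x))) = sets path_space"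
    by (rule sets_quenched_law[OF types_env])
  show "finite_measure (quenched_law (\<lambda>x. \<gamma> (t x)))"
    by (rule Q.finite_measure_axioms)
  fix n x
  interpret \<gamma>: prob_space "\<gamma> b" for b
    using \<gamma> by (rule prob_space_step_law)
  have "emeasure (distr (stack_law \<gamma>) path_space (pos t)) {X. \<forall>k\<le>n. X k = x k} =
      emeasure (stack_law \<gamma>) {\<xi> \<in> space (stack_law \<gamma>). \<forall>k\<le>n. pos t \<xi> k = x k}"
    by (subst emeasure_distr[OF measurable_pos_path sets_path_cylinder])
      (auto intro!: arg_cong[where f = "emeasure _"])
  then show "emeasure (quenched_law (\<lambda>x. \<gamma> (t x))) {X. \<forall>k\<le>n. X k = x k} =
      emeasure (distr (stack_law \<gamma>) path_space (pos t)) {X. \<forall>k\<le>n. X k = x k}"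
    by (simp add: emeasure_quenched_law_cylinder[OF types_env] S.emeasure_eq_measure
        measure_pos_cylinder \<gamma>.emeasure_eq_measure prod_ennreal)
qed simp

lemma
  assumes \<xi>: "\<xi> \<in> space (stack_law \<gamma>)"
  shows abs_step_component: "\<bar>real_of_int (\<xi> j $ i)\<bar> \<le> 1"
    and abs_pos_component: "\<bar>real_of_int (pos t \<xi> n $ i)\<bar> \<le> real n"
proof -
  show step: "\<bar>real_of_int (\<xi> j $ i)\<bar> \<le> 1" for j
    using \<xi> unit_steps_component_le[of "\<xi> j" i] by (simp add: space_stack_law del: split_paired_All)
  show "\<bar>real_of_int (pos t \<xi> n $ i)\<bar> \<le> real n"
  proof (induction n)
    case (Suc n)
    with step[of "top_entry t \<xi> n"] show ?case
      by (simp add: pos_Suc)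
  qed simp
qed

section \<open>Expected position in terms of the number of type 1 steps\<close>

lemma integrable_used: "integrable (stack_law \<gamma>) (\<lambda>\<xi>. real (used t \<xi> n True))"
proof -
  interpret prob_space "stack_law \<gamma>"
    by (rule prob_space_stack_law)
  show ?thesis
  proof (rule integrable_const_bound[where B = "real n"])
    show "(\<lambda>\<xi>. real (used t \<xi> n True)) \<in> borel_measurable (stack_law \<gamma>)"
      by (rule measurable_compose[OF measurable_stack_law(2), where g = "\<lambda>c. real (c True)"]) simp
    have "used t \<xi> n True \<le> n" for \<xi>
      using used_add[of t \<xi> n] by linarith
    then show "AE \<xi> in stack_law \<gamma>. norm (real (used t \<xi> n True)) \<le> real n"
      by simp
  qed
qed

text \<open>A Wald-type identity: given the past, each step has the mean of the law at the current
  site, and \<open>m\<close> takes only two values. All \<open>n\<close> steps contribute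
  \<open>m False\<close>, and each type 1 step adds the difference of the means.\<close>

lemma expectation_pos:
  fixes i :: 'd
  defines "m \<equiv> \<lambda>b. \<integral>y. real_of_int (y $ i) \<partial>\<gamma> b"
  shows "(\<integral>\<xi>. real_of_int (pos t \<xi> n $ i) \<partial>stack_law \<gamma>) =
    real n * m False + (m True - m False) * (\<integral>\<xi>. real (used t \<xi> n True) \<partial>stack_law \<gamma>)"
proof (induction n)
  case (Suc n)
  interpret prob_space "stack_law \<gamma>"
    by (rule prob_space_stack_law)
  have int_pos: "integrable (stack_law \<gamma>) (\<lambda>\<xi>. real_of_int (pos t \<xi> n $ i))" for n
  proof (rule integrable_const_bound[where B = "real n"])
    show "(\<lambda>\<xi>. real_of_int (pos t \<xi> n $ i)) \<in> borel_measurable (stack_law \<gamma>)"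
      by (rule measurable_compose[OF measurable_stack_law(1), where g = "\<lambda>x. real_of_int (x $ i)"]) simp
    show "AE \<xi> in stack_law \<gamma>. norm (real_of_int (pos t \<xi> n $ i)) \<le> real n"
      by (rule AE_I2) (simp add: abs_pos_component)
  qed
  have "integrable (stack_law \<gamma>) (\<lambda>\<xi>. real_of_int (pos t \<xi> (Suc n) $ i) - real_of_int (pos t \<xi> n $ i))"
    by (intro Bochner_Integration.integrable_diff int_pos)
  then have int_step: "integrable (stack_law \<gamma>) (\<lambda>\<xi>. real_of_int (\<xi> (top_entry t \<xi> n) $ i))"
    by (simp add: pos_Suc)
  have int_type: "integrable (stack_law \<gamma>) (\<lambda>\<xi>. of_bool (t (pos t \<xi> n)) :: real)"
  proof (rule integrable_const_bound[where B = 1])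
    show "(\<lambda>\<xi>. of_bool (t (pos t \<xi> n)) :: real) \<in> borel_measurable (stack_law \<gamma>)"
      by (rule measurable_compose[OF measurable_stack_law(1), where g = "\<lambda>x. of_bool (t x)"]) simp
  qed auto
  \<comment> \<open>The fresh step formula with weight 1; both bounds are 1, since a coordinate of a
    unit step has absolute value at most 1.\<close>
  have "(\<integral>\<xi>. real_of_int (\<xi> (top_entry t \<xi> n) $ i) \<partial>stack_law \<gamma>) =
      (\<integral>\<xi>. m (t (pos t \<xi> n)) \<partial>stack_law \<gamma>)"
    using integral_fresh_step[of "\<lambda>_. 1" 1 n t "\<lambda>y. real_of_int (y $ i)" 1]
    by (simp add: m_def unit_steps_component_le)
  also have "\<dots> = (\<integral>\<xi>. m False + (m True - m False) * of_bool (t (pos t \<xi> n)) \<partial>stack_law \<gamma>)"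
    by (intro Bochner_Integration.integral_cong refl) (auto split: split_of_bool)
  also have "\<dots> = m False + (m True - m False) * (\<integral>\<xi>. of_bool (t (pos t \<xi> n)) \<partial>stack_law \<gamma>)"
    using int_type by (simp add: prob_space)
  finally have step: "(\<integral>\<xi>. real_of_int (\<xi> (top_entry t \<xi> n) $ i) \<partial>stack_law \<gamma>) =
      m False + (m True - m False) * (\<integral>\<xi>. of_bool (t (pos t \<xi> n)) \<partial>stack_law \<gamma>)" .
  have pos: "(\<integral>\<xi>. real_of_int (pos t \<xi> (Suc n) $ i) \<partial>stack_law \<gamma>) =
      (\<integral>\<xi>. real_of_int (pos t \<xi> n $ i) \<partial>stack_law \<gamma>) +
      (\<integral>\<xi>. real_of_int (\<xi> (top_entry t \<xi> n) $ i) \<partial>stack_law \<gamma>)"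
    using Bochner_Integration.integral_add[OF int_pos int_step] by (simp add: pos_Suc)
  have "(\<integral>\<xi>. real (used t \<xi> (Suc n) True) \<partial>stack_law \<gamma>) =
      (\<integral>\<xi>. real (used t \<xi> n True) \<partial>stack_law \<gamma>) + (\<integral>\<xi>. of_bool (t (pos t \<xi> n)) \<partial>stack_law \<gamma>)"
    using Bochner_Integration.integral_add[OF integrable_used int_type] by (simp add: used_Suc)
  with Suc show ?case
    unfolding pos step by (simp add: algebra_simps)
qed simp

end

subsection \<open>Coupling of the annealed laws\<close>

text \<open>The preimage of a finite-dimensional rectangle under a componentwise map is again such a
  rectangle, so the two measures agree on rectangles. This turns i.i.d. labels into an i.i.d.
  environment.\<close>

lemma distr_PiM_componentwise:
  fixes M :: "'i \<Rightarrow> 'a measure" and N :: "'i \<Rightarrow> 'b measure"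
  assumes M: "\<And>i. prob_space (M i)" and f: "\<And>i. f i \<in> M i \<rightarrow>\<^sub>M N i"
  shows "distr (PiM UNIV M) (PiM UNIV N) (\<lambda>u i. f i (u i)) = PiM UNIV (\<lambda>i. distr (M i) (N i) (f i))"
proof -
  interpret P: prob_space "PiM UNIV M"
    using M by (intro prob_space_PiM)
  have F: "(\<lambda>u i. f i (u i)) \<in> PiM UNIV M \<rightarrow>\<^sub>M PiM UNIV N"
  proof (rule measurable_PiM_single')
    show "(\<lambda>u. f i (u i)) \<in> PiM UNIV M \<rightarrow>\<^sub>M N i" for i
      by (rule measurable_compose[OF measurable_component_singleton[of i UNIV M] f]) simp
    show "(\<lambda>u i. f i (u i)) \<in> space (PiM UNIV M) \<rightarrow> (\<Pi>\<^sub>E i\<in>UNIV. space (N i))"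
      using measurable_space[OF f] by (auto simp: space_PiM)
  qed
  have S: "sets (PiM UNIV N) = sets (PiM UNIV (\<lambda>i. distr (M i) (N i) (f i)))"
    by (intro sets_PiM_cong) auto
  show ?thesis
  proof (rule measure_eqI_PiM_infinite)
    fix A and J :: "'i set"
    assume J: "finite J" and A: "\<And>i. i \<in> J \<Longrightarrow> A i \<in> sets (distr (M i) (N i) (f i))"
    let ?B = "prod_emb UNIV (\<lambda>i. distr (M i) (N i) (f i)) J (Pi\<^sub>E J A)"
    have B: "?B \<in> sets (PiM UNIV N)"
      unfolding S using J A by (intro sets_PiM_I) auto
    have "(\<lambda>u i. f i (u i)) -` ?B \<inter> space (PiM UNIV M) =
        prod_emb UNIV M J (\<Pi>\<^sub>E i\<in>J. f i -` A i \<inter> space (M i))"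
      by (auto simp: prod_emb_def space_PiM PiE_iff measurable_space[OF f])
    then have "emeasure (distr (PiM UNIV M) (PiM UNIV N) (\<lambda>u i. f i (u i))) ?B =
        (\<Prod>i\<in>J. emeasure (M i) (f i -` A i \<inter> space (M i)))"
      using J A f M by (simp add: emeasure_distr[OF F B] emeasure_PiM_emb measurable_sets)
    also have "\<dots> = emeasure (PiM UNIV (\<lambda>i. distr (M i) (N i) (f i))) ?B"
      using J A f M by (subst emeasure_PiM_emb) (auto simp: emeasure_distr intro!: prob_space.prob_space_distr)
    finally show "emeasure (distr (PiM UNIV M) (PiM UNIV N) (\<lambda>u i. f i (u i))) ?B = \<dots>" .
  next
    show "finite_measure (distr (PiM UNIV M) (PiM UNIV N) (\<lambda>u i. f i (u i)))"
      using P.prob_space_distr[OF F] by (rule prob_space.axioms)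
  qed (auto simp: S)
qed

abbreviation unit_uniform :: "real measure" where
  "unit_uniform \<equiv> uniform_measure lborel {0..1}"

lemma prob_space_unit_uniform: "prob_space unit_uniform"
  by (rule prob_space_uniform_measure) auto

lemma distr_unit_uniform_less:
  assumes p: "0 < p" "p < 1"
  shows "distr unit_uniform (count_space UNIV) (\<lambda>r. r < p) = measure_pmf (bernoulli_pmf p)"
proof (rule measure_eqI_countable[where A = UNIV])
  fix b :: bool
  have "emeasure unit_uniform ((\<lambda>r. r < p) -` {b}) = ennreal (if b then p else 1 - p)"
  proof -
    have "emeasure unit_uniform ((\<lambda>r. r < p) -` {b}) =
        emeasure lborel ({0..1} \<inter> (\<lambda>r. r < p) -` {b}) / emeasure lborel {0..1::real}"
    proof (rule emeasure_uniform_measure)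
      have "(\<lambda>r. r < p) -` {b} = (if b then {..<p} else {p..})"
        by (cases b) (simp_all add: set_eq_iff not_less)
      then show "(\<lambda>r. r < p) -` {b} \<in> sets lborel"
        by simp
    qed simp
    also have "{0..1} \<inter> (\<lambda>r. r < p) -` {b} = (if b then {0..<p} else {p..1})"
      using p by (cases b) (simp_all add: set_eq_iff not_less, linarith+)
    finally show ?thesis
      using p by (simp add: divide_ennreal_def)
  qed
  then show "emeasure (distr unit_uniform (count_space UNIV) (\<lambda>r. r < p)) {b} =
      emeasure (measure_pmf (bernoulli_pmf p)) {b}"
    using p by (cases b) (simp_all add: emeasure_distr emeasure_pmf_single)
qed simp_all

text \<open>Thresholding uniform labels at \<open>p\<close> produces independent Bernoulli types.
  The labels do not depend on \<open>p\<close>, so this realises the environments for all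
  \<open>p\<close> on one space, ordered by their type 1 sites.\<close>

lemma env_law_two_point:
  fixes \<gamma> :: "bool \<Rightarrow> (int ^ 'd::finite) measure"
  assumes \<gamma>: "\<And>b. \<gamma> b \<in> space step_laws" and p: "0 < p" "p < 1"
  shows "env_law (two_point (\<gamma> True) (\<gamma> False) p) =
    distr (PiM UNIV (\<lambda>_. unit_uniform)) (PiM UNIV (\<lambda>_. step_laws)) (\<lambda>u x. \<gamma> (u x < p))"
proof -
  have g: "\<gamma> \<in> count_space UNIV \<rightarrow>\<^sub>M step_laws"
    using \<gamma> by simp
  have less: "(\<lambda>r. r < p) \<in> unit_uniform \<rightarrow>\<^sub>M count_space UNIV"
    by measurable
  have "(\<lambda>b. if b then \<gamma> True else \<gamma> False) = \<gamma>"
    by auto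
  then have "two_point (\<gamma> True) (\<gamma> False) p = distr (measure_pmf (bernoulli_pmf p)) step_laws \<gamma>"
    by (simp add: two_point_def)
  also have "\<dots> = distr unit_uniform step_laws (\<lambda>r. \<gamma> (r < p))"
    unfolding distr_unit_uniform_less[OF p, symmetric]
    by (subst distr_distr[OF g less]) (simp add: o_def)
  finally have "env_law (two_point (\<gamma> True) (\<gamma> False) p) =
      PiM UNIV (\<lambda>_. distr unit_uniform step_laws (\<lambda>r. \<gamma> (r < p)))"
    by (simp add: env_law_def)
  also have "\<dots> = distr (PiM UNIV (\<lambda>_. unit_uniform)) (PiM UNIV (\<lambda>_. step_laws)) (\<lambda>u x. \<gamma> (u x < p))"
  proof (rule distr_PiM_componentwise[symmetric])
    show "(\<lambda>r. \<gamma> (r < p)) \<in> unit_uniform \<rightarrow>\<^sub>M step_laws"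
      by (rule measurable_compose[OF less g])
  qed (rule prob_space_unit_uniform)
  finally show ?thesis .
qed

text \<open>The parameter \<open>p\<close> does not occur: it enters only through the threshold
  applied to the labels in the first component.\<close>

definition coupling :: "(bool \<Rightarrow> (int ^ 'd::finite) measure) \<Rightarrow>
    ((int ^ 'd \<Rightarrow> real) \<times> (bool \<times> nat \<Rightarrow> int ^ 'd)) measure" where
  "coupling \<gamma> = PiM UNIV (\<lambda>_. unit_uniform) \<Otimes>\<^sub>M stack_law \<gamma>"

section \<open>The walks for all values of p on one probability space\<close>

context
  fixes \<gamma> :: "bool \<Rightarrow> (int ^ 'd::finite) measure"
  assumes \<gamma>: "\<And>b. \<gamma> b \<in> space step_laws"
begin

lemma prob_space_uniform_labels: "prob_space (PiM UNIV (\<lambda>_::int ^ 'd. unit_uniform))"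
  by (intro prob_space_PiM prob_space_unit_uniform)

lemma pair_prob_space_coupling: "pair_prob_space (PiM UNIV (\<lambda>_::int ^ 'd. unit_uniform)) (stack_law \<gamma>)"
  using prob_space_uniform_labels prob_space_stack_law[of \<gamma>, OF \<gamma>]
  by (simp add: pair_prob_space_def pair_sigma_finite_def prob_space_imp_sigma_finite)

lemma prob_space_coupling: "prob_space (coupling \<gamma>)"
  unfolding coupling_def
  using prob_space_uniform_labels prob_space_stack_law[of \<gamma>, OF \<gamma>] by (rule prob_space_pair)

lemma space_coupling: "z \<in> space (coupling \<gamma>) \<Longrightarrow> snd z \<in> space (stack_law \<gamma>)"
  by (auto simp: coupling_def space_pair_measure)

lemma
  shows measurable_coupling_label: "Measurable.pred (coupling \<gamma>) (\<lambda>z. fst z x < p)"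
    and measurable_coupling_stack: "(\<lambda>z. snd z j) \<in> coupling \<gamma> \<rightarrow>\<^sub>M count_space UNIV"
proof -
  have "(\<lambda>u. u x) \<in> PiM UNIV (\<lambda>_::int ^ 'd. unit_uniform) \<rightarrow>\<^sub>M unit_uniform"
    by (rule measurable_component_singleton) simp
  then have [measurable]: "(\<lambda>u. u x) \<in> borel_measurable (PiM UNIV (\<lambda>_::int ^ 'd. unit_uniform))"
    by (simp cong: measurable_cong_sets)
  show "Measurable.pred (coupling \<gamma>) (\<lambda>z. fst z x < p)"
    unfolding coupling_def by measurable
  show "(\<lambda>z. snd z j) \<in> coupling \<gamma> \<rightarrow>\<^sub>M count_space UNIV"
    unfolding coupling_def
    by (rule measurable_compose[OF measurable_snd measurable_stack_component[OF \<gamma>]])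
qed

lemmas measurable_coupling_walk =
  measurable_pos[OF measurable_coupling_label measurable_coupling_stack]
  measurable_used[OF measurable_coupling_label measurable_coupling_stack]

lemma measurable_coupling_path:
  "(\<lambda>z. pos (\<lambda>x. fst z x < p) (snd z)) \<in> coupling \<gamma> \<rightarrow>\<^sub>M path_space"
proof (rule measurable_PiM_single')
  show "(\<lambda>z. pos (\<lambda>x. fst z x < p) (snd z) n) \<in> coupling \<gamma> \<rightarrow>\<^sub>M count_space UNIV" for n
    by (rule measurable_coupling_walk(1))
qed simp

text \<open>The annealed law averages quenched laws over the labels, and each quenched law is the
  image of the stack law. The double integral is a single integral over the product space.\<close>

lemma annealed_law_two_point:
  assumes p: "0 < p" "p < 1"
  shows "annealed_law (two_point (\<gamma> True) (\<gamma> False) p) =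
    distr (coupling \<gamma>) path_space (\<lambda>z. pos (\<lambda>x. fst z x < p) (snd z))"
proof (rule measure_eqI)
  interpret S: prob_space "stack_law \<gamma>"
    by (rule prob_space_stack_law[of \<gamma>, OF \<gamma>])
  note two = prob_space_two_point[OF \<gamma>[of True] \<gamma>[of False], of p] sets_two_point[OF \<gamma>[of True] \<gamma>[of False], of p]
  have sets_ann: "sets (annealed_law (two_point (\<gamma> True) (\<gamma> False) p)) = sets path_space"
    by (rule sets_annealed_law[OF two])
  then show "sets (annealed_law (two_point (\<gamma> True) (\<gamma> False) p)) =
      sets (distr (coupling \<gamma>) path_space (\<lambda>z. pos (\<lambda>x. fst z x < p) (snd z)))"
    by simp
  fix A assume "A \<in> sets (annealed_law (two_point (\<gamma> True) (\<gamma> False) p))"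
  then have A: "A \<in> sets path_space"
    by (simp only: sets_ann)
  let ?U = "PiM UNIV (\<lambda>_::int ^ 'd. unit_uniform)"
  let ?V = "(\<lambda>z. pos (\<lambda>x. fst z x < p) (snd z)) -` A \<inter> space (coupling \<gamma>)"
  have env: "(\<lambda>u x. \<gamma> (u x < p)) \<in> ?U \<rightarrow>\<^sub>M PiM UNIV (\<lambda>_::int ^ 'd. step_laws)"
  proof (rule measurable_PiM_single')
    have less: "(\<lambda>r. r < p) \<in> unit_uniform \<rightarrow>\<^sub>M count_space UNIV"
      by measurable
    have "\<gamma> \<in> count_space UNIV \<rightarrow>\<^sub>M step_laws"
      using \<gamma> by simp
    then have comp: "(\<lambda>r. \<gamma> (r < p)) \<in> unit_uniform \<rightarrow>\<^sub>M step_laws"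
      by (rule measurable_compose[OF less])
    show "(\<lambda>u. \<gamma> (u x < p)) \<in> ?U \<rightarrow>\<^sub>M step_laws" for x
      by (rule measurable_compose[OF measurable_component_singleton[of x UNIV "\<lambda>_. unit_uniform"] comp]) simp
  qed (use \<gamma> in \<open>simp add: PiE_iff\<close>)
  have quenched: "(\<lambda>w. emeasure (quenched_law w) A) \<in> borel_measurable (PiM UNIV (\<lambda>_::int ^ 'd. step_laws))"
    by (rule measurable_compose[OF measurable_prob_algebraD[OF measurable_quenched_law]
          measurable_emeasure_subprob_algebra[OF A]])
  have "emeasure (annealed_law (two_point (\<gamma> True) (\<gamma> False) p)) A =
      (\<integral>\<^sup>+u. emeasure (quenched_law (\<lambda>x. \<gamma> (u x < p))) A \<partial>?U)"
    unfolding emeasure_annealed_law[OF two A] env_law_two_point[of \<gamma>, OF \<gamma> p]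
    by (rule nn_integral_distr[OF env]) (simp only: measurable_distr_eq1 quenched)
  \<comment> \<open>For fixed labels \<open>u\<close>, the event that the path lies in
    \<open>A\<close> is the section of \<open>?V\<close> at \<open>u\<close>.\<close>
  also have "\<dots> = (\<integral>\<^sup>+u. emeasure (stack_law \<gamma>) (Pair u -` ?V) \<partial>?U)"
  proof (rule nn_integral_cong)
    fix u assume "u \<in> space ?U"
    then have "pos (\<lambda>x. u x < p) -` A \<inter> space (stack_law \<gamma>) = Pair u -` ?V"
      by (auto simp: coupling_def space_pair_measure)
    then show "emeasure (quenched_law (\<lambda>x. \<gamma> (u x < p))) A = emeasure (stack_law \<gamma>) (Pair u -` ?V)"
      using quenched_law_eq_distr[of \<gamma> "\<lambda>x. u x < p", OF \<gamma>]
      by (simp add: emeasure_distr[OF measurable_pos_path[of \<gamma>, OF \<gamma>] A])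
  qed
  also have "\<dots> = emeasure (coupling \<gamma>) ?V"
    using measurable_sets[OF measurable_coupling_path A] unfolding coupling_def
    by (rule S.emeasure_pair_measure_alt[symmetric])
  also have "\<dots> = emeasure (distr (coupling \<gamma>) path_space (\<lambda>z. pos (\<lambda>x. fst z x < p) (snd z))) A"
    by (rule emeasure_distr[OF measurable_coupling_path A, symmetric])
  finally show "emeasure (annealed_law (two_point (\<gamma> True) (\<gamma> False) p)) A = \<dots>" .
qed

section \<open>Expectations on the coupling and their limits\<close>

lemma integrable_coupling_pos:
  "integrable (coupling \<gamma>) (\<lambda>z. real_of_int (pos (\<lambda>x. fst z x < p) (snd z) n $ i))"
proof -
  interpret prob_space "coupling \<gamma>"
    by (rule prob_space_coupling)
  show ?thesis
  proof (rule integrable_const_bound[where B = "real n"])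
    show "(\<lambda>z. real_of_int (pos (\<lambda>x. fst z x < p) (snd z) n $ i)) \<in> borel_measurable (coupling \<gamma>)"
      by (rule measurable_compose[OF measurable_coupling_walk(1), where g = "\<lambda>x. real_of_int (x $ i)"]) simp
    show "AE z in coupling \<gamma>. norm (real_of_int (pos (\<lambda>x. fst z x < p) (snd z) n $ i)) \<le> real n"
      by (rule AE_I2) (simp add: abs_pos_component[of \<gamma>, OF \<gamma> space_coupling])
  qed
qed

lemma integrable_coupling_used:
  "integrable (coupling \<gamma>) (\<lambda>z. real (used (\<lambda>x. fst z x < p) (snd z) n True))"
proof -
  interpret prob_space "coupling \<gamma>"
    by (rule prob_space_coupling)
  show ?thesis
  proof (rule integrable_const_bound[where B = "real n"])
    show "(\<lambda>z. real (used (\<lambda>x. fst z x < p) (snd z) n True)) \<in> borel_measurable (coupling \<gamma>)"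
      by (rule measurable_compose[OF measurable_coupling_walk(2), where g = "\<lambda>c. real (c True)"]) simp
    have "used (\<lambda>x. fst z x < p) (snd z) n True \<le> n" for z :: "(int ^ 'd \<Rightarrow> real) \<times> (bool \<times> nat \<Rightarrow> int ^ 'd)"
      using used_add[of "\<lambda>x. fst z x < p" "snd z" n] by linarith
    then show "AE z in coupling \<gamma>. norm (real (used (\<lambda>x. fst z x < p) (snd z) n True)) \<le> real n"
      by simp
  qed
qed

text \<open>The identity holds for each fixed choice of labels with coefficients that involve
  neither the labels nor \<open>p\<close>, so it survives integration over the labels.\<close>

lemma expectation_coupling_pos:
  fixes i :: 'd
  defines "m \<equiv> \<lambda>b. \<integral>y. real_of_int (y $ i) \<partial>\<gamma> b"
  shows "(\<integral>z. real_of_int (pos (\<lambda>x. fst z x < p) (snd z) n $ i) \<partial>coupling \<gamma>) =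
    real n * m False + (m True - m False) * (\<integral>z. real (used (\<lambda>x. fst z x < p) (snd z) n True) \<partial>coupling \<gamma>)"
proof -
  let ?U = "PiM UNIV (\<lambda>_::int ^ 'd. unit_uniform)"
  interpret PP: pair_prob_space ?U "stack_law \<gamma>"
    by (rule pair_prob_space_coupling)
  interpret C: prob_space "coupling \<gamma>"
    by (rule prob_space_coupling)
  let ?P = "\<lambda>z. real_of_int (pos (\<lambda>x. fst z x < p) (snd z) n $ i)"
  let ?N = "\<lambda>z. real n * m False + (m True - m False) * real (used (\<lambda>x. fst z x < p) (snd z) n True)"
  have int_N: "integrable (coupling \<gamma>) ?N"
    by (intro Bochner_Integration.integrable_add integrable_mult_right integrable_coupling_used) simp
  have "(\<integral>z. ?P z \<partial>coupling \<gamma>) = (\<integral>u. \<integral>\<xi>. ?P (u, \<xi>) \<partial>stack_law \<gamma> \<partial>?U)"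
    using integrable_coupling_pos[of p n i] unfolding coupling_def by (rule PP.integral_fst'[symmetric])
  also have "\<dots> = (\<integral>u. \<integral>\<xi>. ?N (u, \<xi>) \<partial>stack_law \<gamma> \<partial>?U)"
  proof (rule Bochner_Integration.integral_cong[OF refl])
    fix u :: "int ^ 'd \<Rightarrow> real"
    have "integrable (stack_law \<gamma>) (\<lambda>\<xi>. real (used (\<lambda>x. u x < p) \<xi> n True))"
      by (rule integrable_used[of \<gamma>, OF \<gamma>])
    then show "(\<integral>\<xi>. ?P (u, \<xi>) \<partial>stack_law \<gamma>) = (\<integral>\<xi>. ?N (u, \<xi>) \<partial>stack_law \<gamma>)"
      using expectation_pos[of \<gamma> "\<lambda>x. u x < p" n i, OF \<gamma>] by (simp add: m_def PP.M2.prob_space)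
  qed
  also have "\<dots> = (\<integral>z. ?N z \<partial>coupling \<gamma>)"
    using int_N unfolding coupling_def by (rule PP.integral_fst')
  also have "\<dots> = real n * m False + (m True - m False) *
      (\<integral>z. real (used (\<lambda>x. fst z x < p) (snd z) n True) \<partial>coupling \<gamma>)"
    using integrable_coupling_used[of p n] by (simp add: C.prob_space)
  finally show ?thesis .
qed

lemma expectation_used_mono:
  assumes "p \<le> q"
  shows "(\<integral>z. real (used (\<lambda>x. fst z x < p) (snd z) n True) \<partial>coupling \<gamma>) \<le>
    (\<integral>z. real (used (\<lambda>x. fst z x < q) (snd z) n True) \<partial>coupling \<gamma>)"
  by (intro integral_mono integrable_coupling_used)
    (use assms in \<open>auto intro!: used_mono\<close>)

text \<open>A coordinate of the position moves by at most 1 per step, so the quotients are bounded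
  by 1. Dominated convergence upgrades the almost sure limit to a limit of expectations.\<close>

lemma expectation_pos_tendsto_velocity:
  assumes p: "0 < p" "p < 1"
    and lim: "\<P>(X in annealed_law (two_point (\<gamma> True) (\<gamma> False) p).
      (\<lambda>n. inverse (real n) *\<^sub>R real_vec (X n)) \<longlonglongrightarrow> v) = 1"
  shows "(\<lambda>n. (\<integral>z. real_of_int (pos (\<lambda>x. fst z x < p) (snd z) n $ i) \<partial>coupling \<gamma>) / real n)
    \<longlonglongrightarrow> v $ i"
proof -
  let ?X = "\<lambda>z. pos (\<lambda>x. fst z x < p) (snd z)"
  interpret C: prob_space "coupling \<gamma>"
    by (rule prob_space_coupling)
  interpret D: prob_space "distr (coupling \<gamma>) path_space ?X"
    by (rule C.prob_space_distr[OF measurable_coupling_path])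
  have "AE X in distr (coupling \<gamma>) path_space ?X. (\<lambda>n. inverse (real n) *\<^sub>R real_vec (X n)) \<longlonglongrightarrow> v"
    using lim unfolding annealed_law_two_point[OF p]
    by (subst (asm) D.prob_Collect_eq_1) (simp_all add: measurable_convergence_event[simplified])
  then have "AE z in coupling \<gamma>. (\<lambda>n. inverse (real n) *\<^sub>R real_vec (?X z n)) \<longlonglongrightarrow> v"
    by (rule AE_distrD[OF measurable_coupling_path])
  then have ae: "AE z in coupling \<gamma>. (\<lambda>n. real_of_int (?X z n $ i) / real n) \<longlonglongrightarrow> v $ i"
  proof eventually_elim
    case (elim z)
    from tendsto_vec_nth[OF elim, of i] show ?case
      by (simp add: real_vec_def divide_inverse mult.commute)
  qed
  have "(\<lambda>n. \<integral>z. real_of_int (?X z n $ i) / real n \<partial>coupling \<gamma>) \<longlonglongrightarrow> (\<integral>z. v $ i \<partial>coupling \<gamma>)"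
  proof (rule integral_dominated_convergence[where w = "\<lambda>_. 1"])
    show "(\<lambda>z. real_of_int (?X z n $ i) / real n) \<in> borel_measurable (coupling \<gamma>)" for n
      by (intro borel_measurable_divide borel_measurable_integrable[OF integrable_coupling_pos]) simp
    show "AE z in coupling \<gamma>. norm (real_of_int (?X z n $ i) / real n) \<le> 1" for n
    proof (rule AE_I2)
      fix z assume "z \<in> space (coupling \<gamma>)"
      from abs_pos_component[of \<gamma>, OF \<gamma> space_coupling[OF this]]
      show "norm (real_of_int (?X z n $ i) / real n) \<le> 1"
        \<comment> \<open>At \<open>n = 0\<close> the quotient is 0, because division by zero yields
          0.\<close>
        by (cases "n = 0") (simp_all add: divide_le_eq)
    qed
  qed (use ae in simp_all)
  then show ?thesis
    by (simp add: C.prob_space)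
qed

end

section \<open>Monotonicity of the velocity\<close>

theorem theorem1p7:
  fixes \<gamma>1 \<gamma>2 :: "(int ^ 'd::finite) measure" and v :: "real \<Rightarrow> real ^ 'd"
  assumes "CARD('d) \<ge> 2"
    and "\<gamma>1 \<in> space step_laws" and "\<gamma>2 \<in> space step_laws" and "\<gamma>1 \<noteq> \<gamma>2"
    and "\<And>p. p \<in> {0<..<1} \<Longrightarrow>
      \<P>(X in annealed_law (two_point \<gamma>1 \<gamma>2 p).
        (\<lambda>n. inverse (real n) *\<^sub>R real_vec (X n)) \<longlonglongrightarrow> v p) = 1"
  shows "\<forall>i. mono_on {0<..<1} (\<lambda>p. v p $ i) \<or> antimono_on {0<..<1} (\<lambda>p. v p $ i)"
proof
  fix i :: 'd
  \<comment> \<open>\<open>True\<close> stands for type 1, in accordance with the convention that a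
    label below \<open>p\<close> selects \<open>\<gamma>1\<close>.\<close>
  define \<gamma> where "\<gamma> b = (if b then \<gamma>1 else \<gamma>2)" for b
  have \<gamma>: "\<gamma> b \<in> space step_laws" for b
    using assms(2,3) by (simp add: \<gamma>_def)
  define m where "m b = (\<integral>y. real_of_int (y $ i) \<partial>\<gamma> b)" for b
  define L where "L p n = (\<integral>z. real (used (\<lambda>x. fst z x < p) (snd z) n True) \<partial>coupling \<gamma>)" for p n
  have lim: "(\<lambda>n. (real n * m False + (m True - m False) * L p n) / real n) \<longlonglongrightarrow> v p $ i"
    if "p \<in> {0<..<1}" for p
    using expectation_pos_tendsto_velocity[of \<gamma> p "v p" i, OF \<gamma>] assms(5)[OF that] that
    unfolding expectation_coupling_pos[of \<gamma>, OF \<gamma>] by (simp add: \<gamma>_def m_def L_def)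
  have L: "L p n \<le> L q n" if "p \<le> q" for p q n
    unfolding L_def using expectation_used_mono[of \<gamma>, OF \<gamma> that] .
  \<comment> \<open>The sign of \<open>m True - m False\<close> decides the direction for coordinate
    \<open>i\<close>, and it is the same for all \<open>p\<close>. The inequality between the
    prelimits holds for every \<open>n\<close> and passes to the limit.\<close>
  show "mono_on {0<..<1} (\<lambda>p. v p $ i) \<or> antimono_on {0<..<1} (\<lambda>p. v p $ i)"
  proof (cases "m False \<le> m True")
    case True
    have "v p $ i \<le> v q $ i" if "p \<in> {0<..<1}" "q \<in> {0<..<1}" "p \<le> q" for p q
    proof (rule LIMSEQ_le[OF lim[OF that(1)] lim[OF that(2)]], intro exI allI impI)
      fix n
      show "(real n * m False + (m True - m False) * L p n) / real n
          \<le> (real n * m False + (m True - m False) * L q n) / real n"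
        using True by (intro divide_right_mono add_left_mono mult_left_mono L[OF that(3)]) simp_all
    qed
    then show ?thesis
      by (simp add: monotone_on_def)
  next
    case False
    have "v q $ i \<le> v p $ i" if "p \<in> {0<..<1}" "q \<in> {0<..<1}" "p \<le> q" for p q
    proof (rule LIMSEQ_le[OF lim[OF that(2)] lim[OF that(1)]], intro exI allI impI)
      fix n
      show "(real n * m False + (m True - m False) * L q n) / real n
          \<le> (real n * m False + (m True - m False) * L p n) / real n"
        using False by (intro divide_right_mono add_left_mono mult_left_mono_neg L[OF that(3)]) simp_all
    qed
    then show ?thesis
      by (simp add: monotone_on_def)
  qed
qed

end
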